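(* Let $P$ and $\widetilde P$ be stochastic matrices indexed by $\mathbb F$, each irreducible and positive recurrent, and let $\pi$ be the stationary probability vector of $P$. Suppose that (i) $\widetilde P\in\mathsf{BM}_d$; (ii) $P\prec_d\widetilde P$; and (iii) there exist a real column vector $v=(v(k,i))_{(k,i)\in\mathbb F}$ with $v(k,i)\ge1$ and $v(k,i)\le v(k+1,i)$ for all $(k,i)\in\mathbb F$, and constants $\gamma\in(0,1)$, $b\in(0,\infty)$, such that $$\widetilde Pv\le\gamma v+b\,\mathbf 1_0 .$$ Then for all $n\in\mathbb N$ and all $m\in\mathbb N$, $$\left\|{}_{(n)}\pi_n-\pi\right\|\le \frac{b}{1-\gamma}\left(4\gamma^m+2m\sum_{i\in\mathbb D}\frac{1}{v(n,i)}\right).$$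
   Context: Notation: $\mathbb N=\{1,2,\dots\}$, $\mathbb Z_+=\{0,1,2,\dots\}$, $d\in\mathbb N$, $\mathbb D=\{1,\dots,d\}$, $\mathbb F=\mathbb Z_+\times\mathbb D$. Vector and matrix inequalities are entrywise. $P=(p(k,i;l,j))$ and $\widetilde P=(\widetilde p(k,i;l,j))$ with $(k,i),(l,j)\in\mathbb F$. $\widetilde P\in\mathsf{BM}_d$ (block-monotone with block size $d$) means $\sum_{m\ge l}\widetilde p(k,i;m,j)\le\sum_{m\ge l}\widetilde p(k+1,i;m,j)$ for all $k,l\in\mathbb Z_+$ and $i,j\in\mathbb D$. $P\prec_d\widetilde P$ ($P$ is block-wise dominated by $\widetilde P$) means $\sum_{m\ge l}p(k,i;m,j)\le\sum_{m\ge l}\widetilde p(k,i;m,j)$ for all $k,l\in\mathbb Z_+$ and $i,j\in\mathbb D$. $\mathbf 1_0$ is the column vector indexed by $\mathbb F$ whose $(k,i)$ entry is $1$ if $k=0$ and $0$ if $k\ge1$. For $n\in\mathbb N$, the last-column-block-augmented truncation ${}_{(n)}P_n=({}_{(n)}p_n(k,i;l,j))$ of $P$ is the stochastic matrix indexed by $\mathbb F$ with ${}_{(n)}p_n(k,i;l,j)=p(k,i;l,j)$ for $l\le n-1$, ${}_{(n)}p_n(k,i;n,j)=\sum_{m\ge n}p(k,i;m,j)$, and ${}_{(n)}p_n(k,i;l,j)=0$ for $l>n$. ${}_{(n)}\pi_n=({}_{(n)}\pi_n(k,i))_{(k,i)\in\mathbb F}$ denotes a stationary probability vector of ${}_{(n)}P_n$.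 $\|x\|=\sum_{(k,i)\in\mathbb F}|x(k,i)|$ for a row vector $x$. *)

theory Defs
  imports "HOL-Analysis.Analysis"
begin

text \<open>
  The finite index set \<open>{1, ..., d}\<close> is rendered as the universe of a type \<open>'d :: finite\<close> with
  \<open>d = CARD('d)\<close>, so that block-structured matrices are indexed by \<open>nat \<times> 'd\<close>: the first component
  is the level, the second the phase. The order of the phases plays no role.
\<close>

type_synonym 'a vec = "'a \<Rightarrow> real"
type_synonym 'a mat = "'a \<Rightarrow> 'a \<Rightarrow> real"

definition stochastic :: "'a mat \<Rightarrow> bool" where
  "stochastic P \<longleftrightarrow> (\<forall>x y. 0 \<le> P x y) \<and> (\<forall>x. (P x has_sum 1) UNIV)"

fun mat_pow :: "'a mat \<Rightarrow> nat \<Rightarrow> 'a mat" where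
  "mat_pow P 0 = (\<lambda>x y. if x = y then 1 else 0)"
| "mat_pow P (Suc n) = (\<lambda>x y. \<Sum>\<^sub>\<infinity>z. mat_pow P n x z * P z y)"

definition irreducible_chain :: "'a mat \<Rightarrow> bool" where
  "irreducible_chain P \<longleftrightarrow> (\<forall>x y. \<exists>n. 0 < mat_pow P n x y)"

text \<open>
  \<open>first_passage P y n x\<close> is the probability that the chain with transition matrix \<open>P\<close>, started at
  \<open>x\<close>, visits \<open>y\<close> at time \<open>n\<close> and at no time in \<open>{1..<n}\<close>; the value at \<open>n = 0\<close> is \<open>0\<close>, so \<open>x = y\<close>
  gives the law of the return time.
\<close>

fun first_passage :: "'a mat \<Rightarrow> 'a \<Rightarrow> nat \<Rightarrow> 'a \<Rightarrow> real" where
  "first_passage P y 0 x = 0"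
| "first_passage P y (Suc 0) x = P x y"
| "first_passage P y (Suc (Suc n)) x =
     (\<Sum>\<^sub>\<infinity>z\<in>-{y}. P x z * first_passage P y (Suc n) z)"

text \<open>Every state is revisited almost surely, with finite mean return time.\<close>

definition positive_recurrent :: "'a mat \<Rightarrow> bool" where
  "positive_recurrent P \<longleftrightarrow>
     (\<forall>x. (\<lambda>n. first_passage P x n x) sums 1 \<and> summable (\<lambda>n. real n * first_passage P x n x))"

definition stationary_prob :: "'a mat \<Rightarrow> 'a vec \<Rightarrow> bool" where
  "stationary_prob P p \<longleftrightarrow>
     (\<forall>x. 0 \<le> p x) \<and> (p has_sum 1) UNIV \<and> (\<forall>y. ((\<lambda>x. p x * P x y) has_sum p y) UNIV)"

definition l1_norm :: "'a vec \<Rightarrow> real" where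
  "l1_norm x = (\<Sum>\<^sub>\<infinity>a. \<bar>x a\<bar>)"

definition block_monotone :: "(nat \<times> 'd::finite) mat \<Rightarrow> bool" where
  "block_monotone P \<longleftrightarrow>
     (\<forall>k l i j. (\<Sum>\<^sub>\<infinity>m\<in>{l..}. P (k, i) (m, j)) \<le> (\<Sum>\<^sub>\<infinity>m\<in>{l..}. P (k + 1, i) (m, j)))"

definition block_dominated :: "(nat \<times> 'd::finite) mat \<Rightarrow> (nat \<times> 'd) mat \<Rightarrow> bool" where
  "block_dominated P Q \<longleftrightarrow>
     (\<forall>k l i j. (\<Sum>\<^sub>\<infinity>m\<in>{l..}. P (k, i) (m, j)) \<le> (\<Sum>\<^sub>\<infinity>m\<in>{l..}. Q (k, i) (m, j)))"

definition level0_indicator :: "(nat \<times> 'd::finite) vec" where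
  "level0_indicator = (\<lambda>(k, i). if k = 0 then 1 else 0)"

definition lcb_truncation :: "nat \<Rightarrow> (nat \<times> 'd::finite) mat \<Rightarrow> (nat \<times> 'd) mat" where
  "lcb_truncation n P = (\<lambda>x (l, j).
     if l < n then P x (l, j)
     else if l = n then (\<Sum>\<^sub>\<infinity>m\<in>{n..}. P x (m, j))
     else 0)"

text \<open>
  The inequality \<open>P v \<le> \<gamma> v + b 1\<^sub>0\<close> for a nonnegative vector \<open>v\<close>. As \<open>infsum\<close> is \<open>0\<close> on divergent
  real sums, the finiteness of \<open>P v\<close>, implicit in the inequality, has to be stated.
\<close>

definition drift_ineq ::
    "(nat \<times> 'd::finite) mat \<Rightarrow> (nat \<times> 'd) vec \<Rightarrow> real \<Rightarrow> real \<Rightarrow> bool" where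
  "drift_ineq P v \<gamma> b \<longleftrightarrow>
     (\<forall>x. (\<lambda>y. P x y * v y) summable_on UNIV \<and>
          (\<Sum>\<^sub>\<infinity>y. P x y * v y) \<le> \<gamma> * v x + b * level0_indicator x)"

end

theory Submission
  imports Defs
begin

text \<open>
  Let \<open>T f x = mean (P x) f\<close>, let \<open>T\<^sub>n\<close> be the analogous operator of the truncation, and put
  \<open>B = b / (1 - \<gamma>)\<close>. The \<open>l\<^sub>1\<close> distance is \<open>\<pi>\<^sub>n g - \<pi> g = \<pi>\<^sub>n T\<^sub>n\<^sup>m g - \<pi> T\<^sup>m g\<close> for
  \<open>g = sgn (\<pi>\<^sub>n - \<pi>)\<close>. Monotonicity and dominance force \<open>P\<close>, \<open>Q\<close> and the truncation to have the same
  autonomous phase chain, so \<open>\<pi>\<^sub>n\<close> and \<open>\<pi>\<close> have the same phase marginals, and both can be compared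
  with their projections to level 0. The cost of this comparison is the oscillation of \<open>T\<^sup>m g\<close>
  below a level, at most \<open>2 \<gamma>\<^sup>m v\<close>: instead of coupling chains until the dominating one
  reaches level 0, one propagates level-monotone upper and lower envelopes by \<open>Q\<close> and lets
  them meet at level 0. At level 0, \<open>T\<^sup>m g\<close> and \<open>T\<^sub>n\<^sup>m g\<close> differ through jumps above level \<open>n\<close>
  only; by Markov's inequality each step contributes at most \<open>2 B \<Sum>\<^sub>i 1 / v (n, i)\<close>. The
  integrals of \<open>v\<close> are at most \<open>B\<close> because the drift inequality passes from \<open>Q\<close> to the dominated
  chains.
\<close>

subsection \<open>Expectations and stationary vectors\<close>

definition prob_vec :: "'a vec \<Rightarrow> bool" where
  "prob_vec p \<longleftrightarrow> (\<forall>x. 0 \<le> p x) \<and> (p has_sum 1) UNIV"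

text \<open>As \<open>infsum\<close> is 0 on families that are not summable, comparison and
  additivity need summability, which boundedness supplies for test functions but not for
  \<open>v\<close>. Scaling and negation hold regardless.\<close>

definition mean :: "'a vec \<Rightarrow> 'a vec \<Rightarrow> real" where
  "mean p f = (\<Sum>\<^sub>\<infinity>x. p x * f x)"

lemma stochastic_row: "stochastic R \<Longrightarrow> prob_vec (R x)"
  by (auto simp: stochastic_def prob_vec_def)

lemma stochastic_nonneg: "stochastic R \<Longrightarrow> 0 \<le> R x y"
  by (auto simp: stochastic_def)

lemma prob_vec_nonneg: "prob_vec p \<Longrightarrow> 0 \<le> p x"
  by (auto simp: prob_vec_def)

lemma prob_vec_has_sum: "prob_vec p \<Longrightarrow> (p has_sum 1) UNIV"
  by (auto simp: prob_vec_def)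

lemma prob_vec_summable: "prob_vec p \<Longrightarrow> p summable_on A"
  using summable_on_subset_banach[OF has_sum_imp_summable[OF prob_vec_has_sum]] by blast

lemma summable_on_abs_dominated:
  fixes f g :: "'a \<Rightarrow> real"
  assumes "g summable_on A" and "\<And>x. x \<in> A \<Longrightarrow> \<bar>f x\<bar> \<le> g x"
  shows "f summable_on A"
proof -
  have "(\<lambda>x. \<bar>f x\<bar>) summable_on A"
    by (rule summable_on_comparison_test[OF assms]) auto
  then show ?thesis by (subst summable_on_iff_abs_summable_on_real) simp
qed

lemma mean_const: "prob_vec p \<Longrightarrow> mean p (\<lambda>_. c) = c"
  unfolding mean_def
  using has_sum_cmult_left[OF prob_vec_has_sum, of p c] by (auto intro: infsumI)

lemma summable_mean_bounded:
  assumes "prob_vec p" and "\<And>x. \<bar>f x\<bar> \<le> c"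
  shows "(\<lambda>x. p x * f x) summable_on A"
proof (rule summable_on_abs_dominated)
  show "(\<lambda>x. p x * c) summable_on A"
    by (intro summable_on_cmult_left prob_vec_summable assms)
  show "\<bar>p x * f x\<bar> \<le> p x * c" for x
    using assms prob_vec_nonneg[OF assms(1), of x] by (simp add: abs_mult mult_left_mono)
qed

lemma mean_mono:
  assumes "prob_vec p" and "(\<lambda>x. p x * f x) summable_on UNIV" "(\<lambda>x. p x * g x) summable_on UNIV"
    and "\<And>x. f x \<le> g x"
  shows "mean p f \<le> mean p g"
  unfolding mean_def using assms
  by (intro infsum_mono) (auto intro: mult_left_mono prob_vec_nonneg)

lemma mean_diff:
  assumes "(\<lambda>x. p x * f x) summable_on UNIV" "(\<lambda>x. p x * g x) summable_on UNIV"
  shows "(\<lambda>x. p x * (f x - g x)) summable_on UNIV"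
    and "mean p (\<lambda>x. f x - g x) = mean p f - mean p g"
proof -
  have "((\<lambda>x. p x * f x + (-1) * (p x * g x)) has_sum (mean p f + (-1) * mean p g)) UNIV"
    unfolding mean_def by (intro has_sum_add has_sum_cmult_right has_sum_infsum assms)
  then have "((\<lambda>x. p x * (f x - g x)) has_sum (mean p f - mean p g)) UNIV"
    by (simp add: algebra_simps)
  then show "(\<lambda>x. p x * (f x - g x)) summable_on UNIV"
    and "mean p (\<lambda>x. f x - g x) = mean p f - mean p g"
    unfolding mean_def by (auto simp: summable_on_def dest: infsumI)
qed

lemma mean_affine:
  assumes "prob_vec p" and "(\<lambda>x. p x * f x) summable_on UNIV"
  shows "(\<lambda>x. p x * (c * f x + e)) summable_on UNIV"
    and "mean p (\<lambda>x. c * f x + e) = c * mean p f + e"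
proof -
  have "((\<lambda>x. c * (p x * f x) + p x * e) has_sum (c * mean p f + 1 * e)) UNIV"
    unfolding mean_def
    by (intro has_sum_add has_sum_cmult_left has_sum_cmult_right has_sum_infsum assms
        prob_vec_has_sum)
  then have "((\<lambda>x. p x * (c * f x + e)) has_sum (c * mean p f + e)) UNIV"
    by (simp add: algebra_simps)
  then show "(\<lambda>x. p x * (c * f x + e)) summable_on UNIV"
    and "mean p (\<lambda>x. c * f x + e) = c * mean p f + e"
    unfolding mean_def by (auto simp: summable_on_def dest: infsumI)
qed

lemma abs_mean_le:
  assumes "prob_vec p" and "\<And>x. \<bar>f x\<bar> \<le> c"
  shows "\<bar>mean p f\<bar> \<le> c"
proof -
  have s: "(\<lambda>x. p x * f x) summable_on UNIV" "(\<lambda>x. p x * e) summable_on UNIV" for e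
    using assms by (auto intro: summable_mean_bounded)
  have "mean p f \<le> mean p (\<lambda>_. c)" "mean p (\<lambda>_. - c) \<le> mean p f"
    using assms(2) by (auto intro!: mean_mono[OF assms(1)] s simp: abs_le_iff minus_le_iff)
  then show ?thesis by (simp add: mean_const assms)
qed

lemma mean_uminus: "mean p (\<lambda>x. - f x) = - mean p f"
  by (simp add: mean_def infsum_uminus)

lemma mean_add:
  assumes "(\<lambda>x. p x * f x) summable_on UNIV" "(\<lambda>x. p x * g x) summable_on UNIV"
  shows "(\<lambda>x. p x * (f x + g x)) summable_on UNIV"
    and "mean p (\<lambda>x. f x + g x) = mean p f + mean p g"
  using mean_diff[of p f "\<lambda>x. - g x"] assms
  by (simp_all add: summable_on_uminus mean_uminus)

lemma mean_cmult: "mean p (\<lambda>x. c * f x) = c * mean p f"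
  unfolding mean_def by (subst infsum_cmult_right'[symmetric]) (simp add: mult.left_commute)

lemma summable_mean_cmult:
  fixes p :: "'a vec"
  shows "(\<lambda>x. p x * f x) summable_on UNIV \<Longrightarrow> (\<lambda>x. p x * (c * f x)) summable_on UNIV"
  using summable_on_cmult_right[of "\<lambda>x. p x * f x" UNIV c] by (simp add: mult.left_commute)

lemma abs_mean_le_mean:
  assumes p: "prob_vec p" and w: "(\<lambda>x. p x * w x) summable_on UNIV"
    and h: "\<And>x. \<bar>h x\<bar> \<le> w x"
  shows "(\<lambda>x. p x * h x) summable_on UNIV" and "\<bar>mean p h\<bar> \<le> mean p w"
proof -
  show s: "(\<lambda>x. p x * h x) summable_on UNIV"
    using w by (rule summable_on_abs_dominated)
      (simp add: abs_mult prob_vec_nonneg[OF p] h mult_left_mono)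
  have "mean p h \<le> mean p w"
    by (rule mean_mono[OF p s w]) (use h abs_le_D1 in blast)
  moreover have "mean p (\<lambda>x. - h x) \<le> mean p w"
    by (rule mean_mono[OF p _ w]) (use h abs_le_D2 s in \<open>auto simp: summable_on_uminus\<close>)
  ultimately show "\<bar>mean p h\<bar> \<le> mean p w" by (simp add: mean_uminus)
qed

section \<open>Invariance of stationary vectors and integrals of a drift function\<close>

lemma stationary_prob_vec: "stationary_prob R p \<Longrightarrow> prob_vec p"
  by (auto simp: stationary_prob_def prob_vec_def)

text \<open>Fubini's theorem: \<open>f\<close> is bounded and the weights \<open>p x * R x y\<close>
  have total mass 1, so the double family is absolutely summable; summing over \<open>x\<close>
  first uses the invariance of \<open>p\<close>.\<close>

lemma stationary_mean:
  assumes R: "stochastic R" and p: "stationary_prob R p" and f: "\<And>x. \<bar>f x\<bar> \<le> c"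
  shows "mean p (\<lambda>x. mean (R x) f) = mean p f"
proof -
  have pv: "prob_vec p" using p by (rule stationary_prob_vec)
  have "(\<lambda>(x, y). p x * R x y) summable_on UNIV \<times> UNIV"
  proof (rule summable_on_SigmaI[where g = p])
    show "((\<lambda>y. case (x, y) of (x, y) \<Rightarrow> p x * R x y) has_sum p x) UNIV" for x
      using has_sum_cmult_right[OF prob_vec_has_sum[OF stochastic_row[OF R]], of "p x" x] by simp
    show "p summable_on UNIV" using pv by (rule prob_vec_summable)
  qed (simp add: prob_vec_nonneg[OF pv] stochastic_nonneg[OF R])
  then have "(\<lambda>(x, y). p x * R x y * c) summable_on UNIV \<times> UNIV"
    unfolding case_prod_unfold by (rule summable_on_cmult_left)
  then have "(\<lambda>(x, y). p x * R x y * f y) summable_on UNIV \<times> UNIV"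
  proof (rule summable_on_abs_dominated, clarify)
    fix x y
    have "0 \<le> p x * R x y"
      by (simp add: prob_vec_nonneg[OF pv] stochastic_nonneg[OF R])
    then show "\<bar>p x * R x y * f y\<bar> \<le> p x * R x y * c"
      unfolding abs_mult[of _ "f y"] using f[of y] by (simp add: mult_left_mono)
  qed
  from infsum_swap_banach[OF this]
  have "(\<Sum>\<^sub>\<infinity>x. \<Sum>\<^sub>\<infinity>y. p x * R x y * f y) = (\<Sum>\<^sub>\<infinity>y. \<Sum>\<^sub>\<infinity>x. p x * R x y * f y)" .
  moreover have "(\<Sum>\<^sub>\<infinity>x. p x * R x y * f y) = p y * f y" for y
    using p by (intro infsumI has_sum_cmult_left) (auto simp: stationary_prob_def)
  moreover have "(\<Sum>\<^sub>\<infinity>y. p x * R x y * f y) = p x * mean (R x) f" for x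
    unfolding mean_def by (simp add: infsum_cmult_right' mult.assoc)
  ultimately show ?thesis by (simp add: mean_def)
qed

lemma abs_iterate_le:
  assumes "stochastic R" and "\<And>x. \<bar>g x\<bar> \<le> c"
  shows "\<bar>((\<lambda>f x. mean (R x) f) ^^ m) g x\<bar> \<le> c"
  using assms(2) by (induction m arbitrary: x) (auto intro!: abs_mean_le stochastic_row assms)

lemma stationary_mean_iterate:
  assumes "stochastic R" and "stationary_prob R p" and "\<And>x. \<bar>g x\<bar> \<le> c"
  shows "mean p (((\<lambda>f x. mean (R x) f) ^^ m) g) = mean p g"
  by (induction m) (auto simp: stationary_mean[OF assms(1,2) abs_iterate_le[OF assms(1,3)]])

text \<open>
  Integrability of \<open>v\<close> is not known beforehand, so the drift inequality is integrated for the
  truncations \<open>min v K\<close>.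
\<close>

lemma stationary_mean_drift:
  assumes R: "stochastic R" and p: "stationary_prob R p"
    and sv: "\<And>x. (\<lambda>y. R x y * v y) summable_on UNIV"
    and drift: "\<And>x. mean (R x) v \<le> \<gamma> * v x + b"
    and v: "\<And>x. 0 \<le> v x" and \<gamma>: "0 \<le> \<gamma>" "\<gamma> < 1" and b: "0 \<le> b"
  shows "(\<lambda>x. p x * v x) summable_on UNIV" and "mean p v \<le> b / (1 - \<gamma>)"
proof -
  have pv: "prob_vec p" using p by (rule stationary_prob_vec)
  have bd: "(\<Sum>x\<in>X. p x * v x) \<le> b / (1 - \<gamma>)" if X: "finite X" for X
  proof -
    \<comment> \<open>Any nonnegative height that is at least \<open>v\<close> on \<open>X\<close>
      would do: the truncation then leaves \<open>v\<close> unchanged on \<open>X\<close>.\<close>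
    define K where "K = (\<Sum>x\<in>X. v x)"
    have K: "v x \<le> K" if "x \<in> X" for x
      unfolding K_def using X that v by (intro member_le_sum) auto
    have K0: "0 \<le> K" unfolding K_def by (intro sum_nonneg v)
    let ?f = "\<lambda>x. min (v x) K" and ?h = "\<lambda>x. min (\<gamma> * v x + b) K"
    have f: "\<bar>?f x\<bar> \<le> K" for x using K0 v[of x] by auto
    have h: "\<bar>?h x\<bar> \<le> K" for x using K0 v[of x] \<gamma> b by auto
    have Rf: "\<bar>mean (R x) ?f\<bar> \<le> K" for x
      by (intro abs_mean_le stochastic_row R f)
    have Rh: "mean (R x) ?f \<le> ?h x" for x
    proof -
      have "mean (R x) ?f \<le> mean (R x) v"
        by (rule mean_mono[OF stochastic_row[OF R] summable_mean_bounded[OF stochastic_row[OF R] f] sv])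
          simp
      then show ?thesis using drift[of x] Rf[of x] by simp
    qed
    have sf: "(\<lambda>x. p x * ?f x) summable_on UNIV" and sh: "(\<lambda>x. p x * ?h x) summable_on UNIV"
      and sRf: "(\<lambda>x. p x * mean (R x) ?f) summable_on UNIV"
      by (rule summable_mean_bounded[OF pv f], rule summable_mean_bounded[OF pv h],
          rule summable_mean_bounded[OF pv Rf])
    let ?u = "\<lambda>x. if x \<in> X then v x else 0"
    have su: "((\<lambda>x. p x * ?u x) has_sum (\<Sum>x\<in>X. p x * v x)) UNIV"
      by (subst has_sum_cong_neutral[where T = X and g = "\<lambda>x. p x * v x"]) (auto simp: X)
    then have ssu: "(\<lambda>x. p x * ?u x) summable_on UNIV"
      by (rule has_sum_imp_summable)
    have mu: "mean p ?u = (\<Sum>x\<in>X. p x * v x)"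
      unfolding mean_def using su by (rule infsumI)
    have "0 \<le> mean p ?h - mean p (\<lambda>x. mean (R x) ?f)"
      using mean_mono[OF pv sRf sh Rh] by simp
    also have "\<dots> = mean p ?h - mean p ?f"
      by (simp add: stationary_mean[OF R p f])
    also have "\<dots> = mean p (\<lambda>x. ?h x - ?f x)"
      by (rule mean_diff(2)[OF sh sf, symmetric])
    \<comment> \<open>On \<open>X\<close> the truncation of \<open>v\<close> is inactive, so the gap
      is at most \<open>(\<gamma> - 1) * v x + b\<close>. Off \<open>X\<close> it is at most
      \<open>b\<close>, since \<open>\<gamma> * v x \<le> v x\<close> and capping does not enlarge
      differences.\<close>
    also have "\<dots> \<le> mean p (\<lambda>x. (\<gamma> - 1) * ?u x + b)"
    proof (intro mean_mono pv mean_affine)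
      show "(\<lambda>x. p x * (?h x - ?f x)) summable_on UNIV"
        by (rule mean_diff(1)[OF sh sf])
      show "(\<lambda>x. p x * ?u x) summable_on UNIV" by (rule ssu)
      fix x
      have "\<gamma> * v x \<le> v x" using \<gamma> v[of x] by (simp add: mult_left_le_one_le)
      then show "?h x - ?f x \<le> (\<gamma> - 1) * ?u x + b"
        using K[of x] b by (cases "x \<in> X") (simp_all add: left_diff_distrib min_def)
    qed
    also have "\<dots> = (\<gamma> - 1) * (\<Sum>x\<in>X. p x * v x) + b"
      using mean_affine(2)[OF pv ssu] mu by simp
    finally have "(1 - \<gamma>) * (\<Sum>x\<in>X. p x * v x) \<le> b" by (simp add: algebra_simps)
    then show ?thesis using \<gamma> by (simp add: pos_le_divide_eq mult.commute)
  qed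
  show s: "(\<lambda>x. p x * v x) summable_on UNIV"
    by (rule nonneg_bounded_partial_sums_imp_summable_on[where C = "b / (1 - \<gamma>)"])
      (simp_all add: prob_vec_nonneg[OF pv] v bd eventually_finite_subsets_at_top_weakI)
  show "mean p v \<le> b / (1 - \<gamma>)"
    unfolding mean_def by (rule infsum_le_finite_sums[OF s]) (rule bd)
qed

subsection \<open>Stochastic dominance of block-structured vectors\<close>

lemma infsum_atLeast_eq:
  fixes a :: "nat vec"
  shows "(\<Sum>\<^sub>\<infinity>m\<in>{l..}. a m) = (\<Sum>\<^sub>\<infinity>m. a m * of_bool (l \<le> m))"
  by (rule infsum_cong_neutral) auto

text \<open>Summation by parts: \<open>f\<close> frozen above \<open>N\<close> is \<open>f 0\<close>
  plus the increments \<open>f (Suc l) - f l\<close> times the indicators of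
  \<open>{Suc l..}\<close> for \<open>l < N\<close>. Equal mass handles the constant, the tails
  handle the nonnegative increments. Finite partial sums see only finitely many levels, which
  removes the freezing and yields summability.\<close>

lemma stochastic_dominance:
  fixes a c f :: "nat vec"
  assumes a: "\<And>m. 0 \<le> a m" "a summable_on UNIV" and c: "\<And>m. 0 \<le> c m" "c summable_on UNIV"
    and mass: "(\<Sum>\<^sub>\<infinity>m. a m) = (\<Sum>\<^sub>\<infinity>m. c m)"
    and tails: "\<And>l. (\<Sum>\<^sub>\<infinity>m\<in>{l..}. a m) \<le> (\<Sum>\<^sub>\<infinity>m\<in>{l..}. c m)"
    and f: "mono f" "\<And>m. 0 \<le> f m" and cf: "(\<lambda>m. c m * f m) summable_on UNIV"
  shows "(\<lambda>m. a m * f m) summable_on UNIV" and "(\<Sum>\<^sub>\<infinity>m. a m * f m) \<le> (\<Sum>\<^sub>\<infinity>m. c m * f m)"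
proof -
  have smin: "(\<lambda>m. w m * f (min m N)) summable_on UNIV"
    if "\<And>m. 0 \<le> w m" "w summable_on UNIV" for w :: "nat vec" and N
  proof (rule summable_on_comparison_test)
    show "(\<lambda>m. w m * f N) summable_on UNIV" by (intro summable_on_cmult_left that)
    show "w m * f (min m N) \<le> w m * f N" for m
      by (rule mult_left_mono[OF monoD[OF f(1)] that(1)]) simp
    show "0 \<le> w m * f (min m N)" for m using that f by simp
  qed
  have stail: "(\<lambda>m. w m * of_bool (l \<le> m)) summable_on UNIV"
    if "\<And>m. 0 \<le> w m" "w summable_on UNIV" for w :: "nat vec" and l
    using that(2) by (rule summable_on_comparison_test) (use that in auto)
  have step: "(\<Sum>\<^sub>\<infinity>m. w m * f (min m (Suc N)))
      = (\<Sum>\<^sub>\<infinity>m. w m * f (min m N)) + (f (Suc N) - f N) * (\<Sum>\<^sub>\<infinity>m\<in>{Suc N..}. w m)"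
    if w: "\<And>m. 0 \<le> w m" "w summable_on UNIV" for w :: "nat vec" and N
  proof -
    have "((\<lambda>m. w m * f (min m N) + (f (Suc N) - f N) * (w m * of_bool (Suc N \<le> m))) has_sum
      ((\<Sum>\<^sub>\<infinity>m. w m * f (min m N)) + (f (Suc N) - f N) * (\<Sum>\<^sub>\<infinity>m\<in>{Suc N..}. w m))) UNIV"
      unfolding infsum_atLeast_eq
      by (rule has_sum_add has_sum_cmult_right has_sum_infsum smin stail w)+
    moreover have "w m * f (min m N) + (f (Suc N) - f N) * (w m * of_bool (Suc N \<le> m))
        = w m * f (min m (Suc N))" for m
      by (cases "m \<le> N") (auto simp: min_def algebra_simps not_le le_Suc_eq)
    ultimately show ?thesis by (simp add: infsumI)
  qed
  have le: "(\<Sum>\<^sub>\<infinity>m. a m * f (min m N)) \<le> (\<Sum>\<^sub>\<infinity>m. c m * f (min m N))" for N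
  proof (induction N)
    case 0
    then show ?case by (simp add: infsum_cmult_left' mass)
  next
    case (Suc N)
    have "f N \<le> f (Suc N)" using f(1) by (simp add: monoD)
    then show ?case
      unfolding step[OF a] step[OF c] using Suc tails[of "Suc N"]
      by (intro add_mono mult_left_mono) auto
  qed
  have part: "(\<Sum>m\<in>X. a m * f m) \<le> (\<Sum>\<^sub>\<infinity>m. c m * f m)" if X: "finite X" for X
  proof -
    obtain N where N: "X \<subseteq> {..N}" using X finite_nat_iff_bounded_le by blast
    have "(\<Sum>m\<in>X. a m * f m) = (\<Sum>m\<in>X. a m * f (min m N))"
      using N by (intro sum.cong) (auto simp: min_absorb1)
    also have "\<dots> \<le> (\<Sum>\<^sub>\<infinity>m. a m * f (min m N))"
      by (rule finite_sum_le_infsum[OF smin[OF a] X]) (use a f in auto)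
    also have "\<dots> \<le> (\<Sum>\<^sub>\<infinity>m. c m * f (min m N))" by (rule le)
    also have "\<dots> \<le> (\<Sum>\<^sub>\<infinity>m. c m * f m)"
      by (rule infsum_mono[OF smin[OF c] cf]) (simp add: mult_left_mono monoD[OF f(1)] c(1))
    finally show ?thesis .
  qed
  show s: "(\<lambda>m. a m * f m) summable_on UNIV"
    by (rule nonneg_bounded_partial_sums_imp_summable_on[where C = "\<Sum>\<^sub>\<infinity>m. c m * f m"])
      (simp_all add: a f part eventually_finite_subsets_at_top_weakI)
  show "(\<Sum>\<^sub>\<infinity>m. a m * f m) \<le> (\<Sum>\<^sub>\<infinity>m. c m * f m)"
    by (rule infsum_le_finite_sums[OF s]) (rule part)
qed

section \<open>Sums over levels and phases, and dominance phase by phase\<close>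

lemma has_sum_phases:
  fixes f :: "'l \<times> 'd::finite \<Rightarrow> real"
  assumes "\<And>j. ((\<lambda>l. f (l, j)) has_sum s j) UNIV"
  shows "(f has_sum (\<Sum>j\<in>UNIV. s j)) UNIV"
proof -
  have "(f has_sum (\<Sum>j\<in>UNIV. s j)) (\<Union>j\<in>UNIV. range (\<lambda>l. (l, j)))"
    by (rule sum_has_sum) (use assms in \<open>auto simp: has_sum_reindex inj_on_def o_def\<close>)
  moreover have "(\<Union>j\<in>UNIV. range (\<lambda>l. (l, j))) = (UNIV :: ('l \<times> 'd) set)" by auto
  ultimately show ?thesis by simp
qed

lemma summable_phase:
  fixes f :: "'l \<times> 'd::finite \<Rightarrow> real"
  assumes "f summable_on UNIV"
  shows "(\<lambda>l. f (l, j)) summable_on A"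
proof -
  have "f summable_on (\<lambda>l. (l, j)) ` A"
    using assms by (rule summable_on_subset_banach) simp
  then show ?thesis by (subst (asm) summable_on_reindex) (auto simp: inj_on_def o_def)
qed

lemma infsum_phases:
  fixes f :: "'l \<times> 'd::finite \<Rightarrow> real"
  assumes "f summable_on UNIV"
  shows "infsum f UNIV = (\<Sum>j\<in>UNIV. \<Sum>\<^sub>\<infinity>l. f (l, j))"
  by (intro infsumI has_sum_phases has_sum_infsum summable_phase assms)

text \<open>Common form of both order hypotheses: \<open>block_monotone\<close> compares rows of one
  matrix at consecutive levels, \<open>block_dominated\<close> the same row of two matrices.\<close>

definition tails_le :: "(nat \<times> 'd::finite) vec \<Rightarrow> (nat \<times> 'd) vec \<Rightarrow> bool" where
  "tails_le p q \<longleftrightarrow> (\<forall>l j. (\<Sum>\<^sub>\<infinity>m\<in>{l..}. p (m, j)) \<le> (\<Sum>\<^sub>\<infinity>m\<in>{l..}. q (m, j)))"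

definition phase_marginal :: "(nat \<times> 'd::finite) vec \<Rightarrow> 'd vec" where
  "phase_marginal p j = (\<Sum>\<^sub>\<infinity>l. p (l, j))"

lemma tails_le_trans: "tails_le p q \<Longrightarrow> tails_le q r \<Longrightarrow> tails_le p r"
  unfolding tails_le_def by (meson order_trans)

lemma sum_phase_marginal:
  assumes "prob_vec p"
  shows "(\<Sum>j\<in>UNIV. phase_marginal p j) = 1"
  unfolding phase_marginal_def
  using infsum_phases[OF prob_vec_summable[OF assms]] prob_vec_has_sum[OF assms]
  by (simp add: infsumI)

lemma phase_marginal_nonneg: "prob_vec p \<Longrightarrow> 0 \<le> phase_marginal p j"
  unfolding phase_marginal_def by (simp add: infsum_nonneg prob_vec_nonneg)

lemma le_phase_marginal:
  assumes "prob_vec p"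
  shows "p (l, j) \<le> phase_marginal p j"
  unfolding phase_marginal_def
  using finite_sum_le_infsum[OF summable_phase[OF prob_vec_summable[OF assms]], of "{l}" UNIV j]
  by (simp add: prob_vec_nonneg[OF assms])

text \<open>The tail from level 0 bounds each phase mass of \<open>p\<close> by that of
  \<open>q\<close>; as both families sum to 1, none of these inequalities is strict.\<close>

lemma tails_le_phase_marginal_eq:
  assumes p: "prob_vec p" and q: "prob_vec q" and le: "tails_le p q"
  shows "phase_marginal p j = phase_marginal q j"
proof -
  have "\<forall>j\<in>UNIV. phase_marginal p j \<le> phase_marginal q j"
    using le by (auto simp: tails_le_def phase_marginal_def dest: spec[where x = 0])
  moreover have "(\<Sum>j\<in>UNIV. phase_marginal p j) = (\<Sum>j\<in>UNIV. phase_marginal q j)"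
    by (simp add: sum_phase_marginal p q)
  ultimately show ?thesis
    using sum_mono_inv[of "phase_marginal p" UNIV "phase_marginal q" j] by auto
qed

lemma mean_phase_function:
  assumes p: "prob_vec p"
  shows "mean p (\<lambda>x. F (snd x)) = (\<Sum>j\<in>UNIV. phase_marginal p j * F j)"
  unfolding mean_def
proof (rule infsumI[OF has_sum_phases])
  show "((\<lambda>l. p (l, j) * F (snd (l, j))) has_sum phase_marginal p j * F j) UNIV" for j
    unfolding phase_marginal_def snd_conv
    by (intro has_sum_cmult_left has_sum_infsum summable_phase prob_vec_summable p)
qed

definition level_mono :: "(nat \<times> 'd) vec \<Rightarrow> bool" where
  "level_mono f \<longleftrightarrow> (\<forall>j. mono (\<lambda>l. f (l, j)))"

lemma level_mono_iff_Suc: "level_mono f \<longleftrightarrow> (\<forall>k i. f (k, i) \<le> f (Suc k, i))"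
  by (auto simp: level_mono_def mono_iff_le_Suc)

text \<open>Scalar dominance is applied within each phase; equality of the phase marginals is its
  equal-mass hypothesis.\<close>

lemma tails_le_mean:
  assumes p: "prob_vec p" and q: "prob_vec q" and le: "tails_le p q"
    and f: "level_mono f" "\<And>x. 0 \<le> f x" and qf: "(\<lambda>x. q x * f x) summable_on UNIV"
  shows "(\<lambda>x. p x * f x) summable_on UNIV" and "mean p f \<le> mean q f"
proof -
  have *: "(\<lambda>l. p (l, j) * f (l, j)) summable_on UNIV"
    "(\<Sum>\<^sub>\<infinity>l. p (l, j) * f (l, j)) \<le> (\<Sum>\<^sub>\<infinity>l. q (l, j) * f (l, j))" for j
    by (rule stochastic_dominance[of "\<lambda>l. p (l, j)" "\<lambda>l. q (l, j)" "\<lambda>l. f (l, j)"];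
        use f le tails_le_phase_marginal_eq[OF p q le, of j] summable_phase[OF qf, of j] in
        \<open>simp add: prob_vec_nonneg p q summable_phase prob_vec_summable level_mono_def
          tails_le_def phase_marginal_def\<close>)+
  have "((\<lambda>x. p x * f x) has_sum (\<Sum>j\<in>UNIV. \<Sum>\<^sub>\<infinity>l. p (l, j) * f (l, j))) UNIV"
    by (intro has_sum_phases has_sum_infsum *)
  then show s: "(\<lambda>x. p x * f x) summable_on UNIV" by (rule has_sum_imp_summable)
  show "mean p f \<le> mean q f"
    unfolding mean_def infsum_phases[OF s] infsum_phases[OF qf] by (intro sum_mono *)
qed

lemma tails_le_mean_bounded:
  assumes p: "prob_vec p" and q: "prob_vec q" and le: "tails_le p q"
    and f: "level_mono f" "\<And>x. \<bar>f x\<bar> \<le> c"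
  shows "mean p f \<le> mean q f"
proof -
  have s: "(\<lambda>x. r x * f x) summable_on UNIV" if "prob_vec r" for r
    using that f(2) by (rule summable_mean_bounded)
  \<comment> \<open>Adding \<open>c\<close> makes the integrand nonnegative and shifts both means
    equally; the factor 1 gives it the shape of \<open>mean_affine\<close>.\<close>
  have "mean p (\<lambda>x. 1 * f x + c) \<le> mean q (\<lambda>x. 1 * f x + c)"
  proof (rule tails_le_mean[OF p q le])
    show "level_mono (\<lambda>x. 1 * f x + c)" using f by (auto simp: level_mono_def mono_def)
    show "0 \<le> 1 * f x + c" for x using f(2)[of x] by linarith
    show "(\<lambda>x. q x * (1 * f x + c)) summable_on UNIV" by (rule mean_affine[OF q s[OF q]])
  qed
  then show ?thesis by (simp add: mean_affine(2)[OF _ s, of _ 1, simplified] p q)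
qed

subsection \<open>Contraction of oscillations towards level 0\<close>

text \<open>Above level 0 the envelope is averaged by the monotone \<open>Q\<close>, which dominates
  \<open>R\<close>; at level 0 it takes the exact value, so that upper and lower envelopes meet
  there. Monotonicity from level 0 to level 1 survives because the exact value is at most
  \<open>mean (Q x) U\<close>.\<close>

lemma envelope_step:
  fixes R Q :: "(nat \<times> 'd::finite) mat" and U G :: "(nat \<times> 'd) vec"
  assumes R: "stochastic R" and Q: "stochastic Q" and RQ: "\<And>x. tails_le (R x) (Q x)"
    and Qm: "\<And>k i. tails_le (Q (k, i)) (Q (Suc k, i))"
    and U: "level_mono U" "\<And>x. \<bar>U x\<bar> \<le> 1" and G: "\<And>x. \<bar>G x\<bar> \<le> 1" "\<And>x. G x \<le> U x"
  defines "U' \<equiv> \<lambda>x. if fst x = 0 then mean (R x) G else mean (Q x) U"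
  shows "level_mono U'" and "\<bar>U' x\<bar> \<le> 1" and "mean (R x) G \<le> U' x"
proof -
  have "mean (R x) G \<le> mean (R x) U" for x
    using U G by (intro mean_mono summable_mean_bounded[where c = 1] stochastic_row R) auto
  also have "mean (R x) U \<le> mean (Q x) U" for x
    by (rule tails_le_mean_bounded[OF stochastic_row[OF R] stochastic_row[OF Q] RQ U])
  finally have le: "mean (R x) G \<le> mean (Q x) U" for x .
  have Qmono: "mean (Q (k, i)) U \<le> mean (Q (Suc k, i)) U" for k i
    by (rule tails_le_mean_bounded[OF stochastic_row[OF Q] stochastic_row[OF Q] Qm U])
  show "level_mono U'"
    unfolding level_mono_iff_Suc U'_def using Qmono order_trans[OF le Qmono] by simp
  show "\<bar>U' x\<bar> \<le> 1"
    unfolding U'_def by (simp add: abs_mean_le stochastic_row R Q U G)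
  show "mean (R x) G \<le> U' x" by (simp add: U'_def le)
qed

text \<open>\<open>W\<close> majorizes the negated iterate, so \<open>U + W\<close> is the width of
  a band around the iterate. Each step makes the width 0 at level 0 and averages it by
  \<open>Q\<close> elsewhere, where the drift contracts \<open>v\<close> by \<gamma> without an
  additive term.\<close>

lemma iterate_envelope:
  fixes R Q :: "(nat \<times> 'd::finite) mat" and v g :: "(nat \<times> 'd) vec"
  assumes R: "stochastic R" and Q: "stochastic Q" and RQ: "\<And>x. tails_le (R x) (Q x)"
    and Qm: "\<And>k i. tails_le (Q (k, i)) (Q (Suc k, i))"
    and v: "\<And>x. 1 \<le> v x" and sv: "\<And>x. (\<lambda>y. Q x y * v y) summable_on UNIV"
    and drift: "\<And>x. fst x \<noteq> 0 \<Longrightarrow> mean (Q x) v \<le> \<gamma> * v x" and \<gamma>: "0 \<le> \<gamma>"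
    and g: "\<And>x. \<bar>g x\<bar> \<le> 1"
  shows "\<exists>U W. level_mono U \<and> level_mono W \<and> (\<forall>x. \<bar>U x\<bar> \<le> 1 \<and> \<bar>W x\<bar> \<le> 1 \<and>
    ((\<lambda>f x. mean (R x) f) ^^ m) g x \<le> U x \<and> - ((\<lambda>f x. mean (R x) f) ^^ m) g x \<le> W x \<and>
    U x + W x \<le> 2 * \<gamma> ^ m * v x)"
proof (induction m)
  case 0
  \<comment> \<open>Constant envelopes 1 have width 2, at most \<open>2 * v x\<close>; this is the
    origin of the factor 2.\<close>
  have "g x \<le> 1" "- g x \<le> 1" for x using g[of x] by linarith+
  then show ?case
    using v by (intro exI[of _ "\<lambda>_. 1"]) (auto simp: level_mono_def mono_def)
next
  case (Suc m)
  let ?G = "((\<lambda>f x. mean (R x) f) ^^ m) g"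
  obtain U W where UW: "level_mono U" "level_mono W" "\<And>x. \<bar>U x\<bar> \<le> 1" "\<And>x. \<bar>W x\<bar> \<le> 1"
    "\<And>x. ?G x \<le> U x" "\<And>x. - ?G x \<le> W x" "\<And>x. U x + W x \<le> 2 * \<gamma> ^ m * v x"
    using Suc by auto
  have G: "\<bar>?G x\<bar> \<le> 1" "\<bar>- ?G x\<bar> \<le> 1" for x
    using abs_iterate_le[OF R g] by simp_all
  let ?U = "\<lambda>x. if fst x = 0 then mean (R x) ?G else mean (Q x) U"
  let ?W = "\<lambda>x. if fst x = 0 then mean (R x) (\<lambda>x. - ?G x) else mean (Q x) W"
  note EU = envelope_step[OF R Q RQ Qm UW(1,3) G(1) UW(5)]
  note EW = envelope_step[OF R Q RQ Qm UW(2,4) G(2) UW(6)]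
  have "?U x + ?W x \<le> 2 * \<gamma> ^ Suc m * v x" for x
  proof (cases "fst x = 0")
    case True
    then show ?thesis using \<gamma> order_trans[OF zero_le_one v[of x]] by (simp add: mean_uminus)
  next
    case False
    have sU: "(\<lambda>y. Q x y * U y) summable_on UNIV" and sW: "(\<lambda>y. Q x y * W y) summable_on UNIV"
      using UW by (auto intro!: summable_mean_bounded[where c = 1] stochastic_row Q)
    have "?U x + ?W x = mean (Q x) (\<lambda>y. U y + W y)"
      using False by (simp add: mean_add sU sW)
    also have "\<dots> \<le> mean (Q x) (\<lambda>y. 2 * \<gamma> ^ m * v y)"
      by (rule mean_mono[OF stochastic_row[OF Q] mean_add(1)[OF sU sW] summable_mean_cmult[OF sv]])
        (rule UW(7))
    also have "\<dots> = 2 * \<gamma> ^ m * mean (Q x) v" by (rule mean_cmult)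
    also have "\<dots> \<le> 2 * \<gamma> ^ m * (\<gamma> * v x)"
      using drift[OF False] \<gamma> by (intro mult_left_mono) auto
    finally show ?thesis by (simp add: mult_ac)
  qed
  then show ?case
    using EU EW by (intro exI[of _ ?U] exI[of _ ?W] conjI allI) (simp_all add: mean_uminus)
qed

text \<open>The difference, of either sign, is at most \<open>U\<close> at one of the two points
  plus \<open>W\<close> at the other. Monotonicity raises the argument at level 0 to
  \<open>x\<close>, which leaves the width \<open>U x + W x\<close>.\<close>

lemma iterate_oscillation:
  fixes R Q :: "(nat \<times> 'd::finite) mat" and v g :: "(nat \<times> 'd) vec"
  assumes R: "stochastic R" and Q: "stochastic Q" and RQ: "\<And>x. tails_le (R x) (Q x)"
    and Qm: "\<And>k i. tails_le (Q (k, i)) (Q (Suc k, i))"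
    and v: "\<And>x. 1 \<le> v x" and sv: "\<And>x. (\<lambda>y. Q x y * v y) summable_on UNIV"
    and drift: "\<And>x. fst x \<noteq> 0 \<Longrightarrow> mean (Q x) v \<le> \<gamma> * v x" and \<gamma>: "0 \<le> \<gamma>"
    and g: "\<And>x. \<bar>g x\<bar> \<le> 1"
  shows "\<bar>((\<lambda>f x. mean (R x) f) ^^ m) g (0, snd x) - ((\<lambda>f x. mean (R x) f) ^^ m) g x\<bar>
    \<le> 2 * \<gamma> ^ m * v x"
proof -
  let ?G = "((\<lambda>f x. mean (R x) f) ^^ m) g"
  obtain U W where UW: "level_mono U" "level_mono W" "\<And>x. ?G x \<le> U x" "\<And>x. - ?G x \<le> W x"
    "\<And>x. U x + W x \<le> 2 * \<gamma> ^ m * v x"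
    using iterate_envelope[where R = R and Q = Q and v = v and \<gamma> = \<gamma> and g = g and m = m,
        OF R Q RQ Qm v sv drift \<gamma> g] by auto
  have "F (0, snd x) \<le> F x" if "level_mono F" for F :: "(nat \<times> 'd) vec"
    using that monoD[of "\<lambda>l. F (l, snd x)" 0 "fst x"] by (simp add: level_mono_def)
  from this[OF UW(1)] this[OF UW(2)] have "U (0, snd x) \<le> U x" "W (0, snd x) \<le> W x" .
  then show ?thesis
    using UW(3,4)[of x] UW(3,4)[of "(0, snd x)"] UW(5)[of x] by linarith
qed

subsection \<open>The augmented truncation\<close>

text \<open>Within a phase the truncated row is the image of the original row under
  \<open>l \<mapsto> min l n\<close>. This change of variables yields the masses, tails and means of
  the truncation by choice of \<open>g\<close>.\<close>

lemma has_sum_lcb_truncation_phase: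
  assumes R: "stochastic R"
  shows "((\<lambda>l. lcb_truncation n R x (l, j) * g l)
      has_sum (\<Sum>\<^sub>\<infinity>l. R x (l, j) * g (min l n))) UNIV"
proof -
  have sR: "(\<lambda>l. R x (l, j)) summable_on A" for A
    by (intro summable_phase prob_vec_summable stochastic_row R)
  have UN: "{..<n} \<union> {n..} = UNIV" by auto
  have "((\<lambda>l. R x (l, j) * g (min l n)) has_sum
      ((\<Sum>l<n. R x (l, j) * g l) + (\<Sum>\<^sub>\<infinity>l\<in>{n..}. R x (l, j)) * g n)) ({..<n} \<union> {n..})"
  proof (rule has_sum_Un_disjoint)
    show "((\<lambda>l. R x (l, j) * g (min l n)) has_sum (\<Sum>l<n. R x (l, j) * g l)) {..<n}"
      by (rule has_sum_finiteI) simp_all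
    have "((\<lambda>l. R x (l, j) * g n) has_sum ((\<Sum>\<^sub>\<infinity>l\<in>{n..}. R x (l, j)) * g n)) {n..}"
      by (intro has_sum_cmult_left has_sum_infsum sR)
    then show "((\<lambda>l. R x (l, j) * g (min l n)) has_sum
        ((\<Sum>\<^sub>\<infinity>l\<in>{n..}. R x (l, j)) * g n)) {n..}"
      by (rule has_sum_cong[THEN iffD1, rotated]) simp
  qed auto
  then have "(\<Sum>\<^sub>\<infinity>l. R x (l, j) * g (min l n))
      = (\<Sum>l<n. R x (l, j) * g l) + (\<Sum>\<^sub>\<infinity>l\<in>{n..}. R x (l, j)) * g n"
    by (intro infsumI) (simp add: UN)
  also have "\<dots> = (\<Sum>l\<le>n. lcb_truncation n R x (l, j) * g l)"
    by (simp add: lcb_truncation_def flip: lessThan_Suc_atMost)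
  finally show ?thesis
    by (subst has_sum_cong_neutral[where T = "{..n}"
          and g = "\<lambda>l. lcb_truncation n R x (l, j) * g l"])
      (auto simp: lcb_truncation_def)
qed

lemma lcb_truncation_nonneg:
  assumes "stochastic R"
  shows "0 \<le> lcb_truncation n R x y"
  by (cases y) (auto simp: lcb_truncation_def stochastic_nonneg[OF assms] intro!: infsum_nonneg)

lemma stochastic_lcb_truncation:
  assumes R: "stochastic R"
  shows "stochastic (lcb_truncation n R)"
  unfolding stochastic_def
proof (intro conjI allI)
  fix x
  have "(lcb_truncation n R x has_sum (\<Sum>j\<in>UNIV. phase_marginal (R x) j)) UNIV"
    using has_sum_lcb_truncation_phase[OF R, of n x _ "\<lambda>_. 1"]
    by (intro has_sum_phases) (simp add: phase_marginal_def)
  then show "(lcb_truncation n R x has_sum 1) UNIV"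
    by (simp add: sum_phase_marginal stochastic_row R)
qed (rule lcb_truncation_nonneg[OF R])

lemma mean_lcb_truncation:
  assumes R: "stochastic R" and f: "\<And>x. \<bar>f x\<bar> \<le> c"
  shows "mean (lcb_truncation n R x) f = mean (R x) (\<lambda>(l, j). f (min l n, j))"
proof -
  have "(\<lambda>y. R x y * (\<lambda>(l, j). f (min l n, j)) y) summable_on UNIV"
    by (rule summable_mean_bounded[where c = c]) (auto simp: stochastic_row R f)
  from infsum_phases[OF this] show ?thesis
    unfolding mean_def
    by (intro infsumI)
      (use has_sum_phases[OF has_sum_lcb_truncation_phase[OF R, of n x _ "\<lambda>l. f (l, _)"]]
       in \<open>simp add: case_prod_unfold\<close>)
qed

text \<open>Capping only lowers levels: \<open>l \<le> min m n\<close> implies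
  \<open>l \<le> m\<close>.\<close>

lemma tails_le_lcb_truncation:
  assumes R: "stochastic R"
  shows "tails_le (lcb_truncation n R x) (R x)"
  unfolding tails_le_def
proof (intro allI)
  fix l j
  have sR: "(\<lambda>l. R x (l, j)) summable_on UNIV"
    by (intro summable_phase prob_vec_summable stochastic_row R)
  have s: "(\<lambda>m. R x (m, j) * of_bool (P m)) summable_on UNIV" for P
    using sR by (rule summable_on_comparison_test) (auto simp: stochastic_nonneg[OF R])
  have "(\<Sum>\<^sub>\<infinity>m\<in>{l..}. lcb_truncation n R x (m, j))
      = (\<Sum>\<^sub>\<infinity>m. R x (m, j) * of_bool (l \<le> min m n))"
    unfolding infsum_atLeast_eq
    by (intro infsumI has_sum_lcb_truncation_phase R)
  also have "\<dots> \<le> (\<Sum>\<^sub>\<infinity>m. R x (m, j) * of_bool (l \<le> m))"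
    by (intro infsum_mono s) (auto simp: stochastic_nonneg[OF R])
  finally show "(\<Sum>\<^sub>\<infinity>m\<in>{l..}. lcb_truncation n R x (m, j)) \<le> (\<Sum>\<^sub>\<infinity>m\<in>{l..}. R x (m, j))"
    by (simp only: infsum_atLeast_eq)
qed

text \<open>Markov's inequality: capping changes the argument of \<open>f\<close> only above level
  \<open>n\<close>, at a cost of at most 2, and there \<open>v (l, j)\<close> is at least
  \<open>v (n, j)\<close>. Summing the reciprocals over the phases gives one constant valid for
  every \<open>j\<close>.\<close>

lemma abs_mean_lcb_truncation_diff_le:
  fixes R :: "(nat \<times> 'd::finite) mat" and v f :: "(nat \<times> 'd) vec"
  assumes R: "stochastic R" and v: "\<And>x. 1 \<le> v x" "level_mono v"
    and sv: "(\<lambda>y. R x y * v y) summable_on UNIV" and f: "\<And>x. \<bar>f x\<bar> \<le> 1"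
  shows "\<bar>mean (lcb_truncation n R x) f - mean (R x) f\<bar>
    \<le> 2 * (\<Sum>i\<in>UNIV. 1 / v (n, i)) * mean (R x) v"
proof -
  let ?S = "\<Sum>i\<in>UNIV. 1 / v (n, i)"
  let ?c = "\<lambda>(l, j). f (min l n, j)"
  have v0: "0 < v x" for x using v(1)[of x] by linarith
  have s: "(\<lambda>y. R x y * f y) summable_on UNIV" "(\<lambda>y. R x y * ?c y) summable_on UNIV"
    using f by (auto intro!: summable_mean_bounded[where c = 1] stochastic_row R)
  have pt: "\<bar>?c y - f y\<bar> \<le> 2 * ?S * v y" for y
  proof (cases y)
    case (Pair l j)
    have S0: "0 \<le> ?S" using v0 by (intro sum_nonneg) (simp add: less_imp_le)
    show ?thesis
    proof (cases "l \<le> n")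
      case True
      then show ?thesis using Pair S0 less_imp_le[OF v0[of y]] by (simp add: min_absorb1)
    next
      case False
      have "1 / v (n, j) \<le> ?S"
        using v0 by (intro member_le_sum) (auto simp: less_imp_le)
      then have "1 \<le> ?S * v (n, j)" using v0[of "(n, j)"] by (simp add: field_simps)
      also have "v (n, j) \<le> v y"
        using v(2) False monoD[of "\<lambda>l. v (l, j)" n l] by (simp add: Pair level_mono_def)
      then have "?S * v (n, j) \<le> ?S * v y" using S0 by (rule mult_left_mono)
      finally show ?thesis
        using f[of "(n, j)"] f[of y] False Pair by (simp add: min_absorb2)
    qed
  qed
  have "mean (lcb_truncation n R x) f - mean (R x) f = mean (R x) (\<lambda>y. ?c y - f y)"
    by (simp only: mean_lcb_truncation[OF R f] mean_diff(2)[OF s(2,1)])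
  also have "\<bar>\<dots>\<bar> \<le> mean (R x) (\<lambda>y. 2 * ?S * v y)"
    by (rule abs_mean_le_mean(2)[OF stochastic_row[OF R] summable_mean_cmult[OF sv] pt])
  finally show ?thesis by (simp only: mean_cmult)
qed

text \<open>
  The constant \<open>b / (1 - \<gamma>)\<close> is the fixed point of \<open>t \<mapsto> \<gamma> * t + b\<close>; the excess of \<open>v\<close> over it is
  contracted by \<open>R\<close>.
\<close>

lemma iterate_lcb_truncation_diff_le:
  fixes R :: "(nat \<times> 'd::finite) mat" and v g :: "(nat \<times> 'd) vec" and \<gamma> b :: real
  assumes R: "stochastic R" and v: "\<And>x. 1 \<le> v x" "level_mono v"
    and sv: "\<And>x. (\<lambda>y. R x y * v y) summable_on UNIV"
    and drift: "\<And>x. mean (R x) v \<le> \<gamma> * v x + b" and \<gamma>: "0 \<le> \<gamma>" "\<gamma> < 1"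
    and g: "\<And>x. \<bar>g x\<bar> \<le> 1"
  shows "\<exists>a\<ge>0. \<forall>x. \<bar>((\<lambda>f x. mean (lcb_truncation n R x) f) ^^ m) g x
      - ((\<lambda>f x. mean (R x) f) ^^ m) g x\<bar>
    \<le> 2 * (\<Sum>i\<in>UNIV. 1 / v (n, i)) * (a * (v x - b / (1 - \<gamma>)) + real m * (b / (1 - \<gamma>)))"
proof (induction m)
  case 0
  show ?case by (intro exI[of _ 0]) simp
next
  case (Suc m)
  define S where "S = (\<Sum>i\<in>UNIV. 1 / v (n, i))"
  define B where "B = b / (1 - \<gamma>)"
  let ?G = "((\<lambda>f x. mean (R x) f) ^^ m) g"
  let ?H = "((\<lambda>f x. mean (lcb_truncation n R x) f) ^^ m) g"
  obtain a where a: "0 \<le> a" "\<And>x. \<bar>?H x - ?G x\<bar> \<le> 2 * S * (a * (v x - B) + real m * B)"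
    using Suc unfolding S_def B_def by blast
  have S: "0 \<le> S"
    unfolding S_def using v(1) by (intro sum_nonneg) (simp add: order_trans[OF zero_le_one])
  \<comment> \<open>Hence \<open>\<gamma> * v x + b = \<gamma> * (v x - B) + B\<close>: the excess
    over \<open>B\<close> shrinks by \<gamma>, and each step adds one \<open>B\<close> to
    \<open>real m * B\<close>.\<close>
  have bB: "b = (1 - \<gamma>) * B" using \<gamma> by (simp add: B_def)
  have G: "\<And>x. \<bar>?G x\<bar> \<le> 1" and H: "\<And>x. \<bar>?H x\<bar> \<le> 1"
    by (rule abs_iterate_le[OF R g], rule abs_iterate_le[OF stochastic_lcb_truncation[OF R] g])
  \<comment> \<open>The one-step truncation error on \<open>?H\<close> has coefficient 1, the
    propagated old error has coefficient \<open>a\<close>, and the drift multiplies their sum by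
    \<gamma>; hence the witness \<open>\<gamma> * (1 + a)\<close>.\<close>
  have "\<bar>mean (lcb_truncation n R x) ?H - mean (R x) ?G\<bar>
      \<le> 2 * S * (\<gamma> * (1 + a) * (v x - B) + real (Suc m) * B)" for x
  proof -
    have sG: "(\<lambda>y. R x y * ?G y) summable_on UNIV" and sH: "(\<lambda>y. R x y * ?H y) summable_on UNIV"
      by (rule summable_mean_bounded[OF stochastic_row[OF R] G],
          rule summable_mean_bounded[OF stochastic_row[OF R] H])
    define e where "e = 2 * S * (real m * B - a * B)"
    have "\<bar>mean (R x) (\<lambda>y. ?H y - ?G y)\<bar> \<le> mean (R x) (\<lambda>y. 2 * S * a * v y + e)"
      by (rule abs_mean_le_mean(2)[OF stochastic_row[OF R] mean_affine(1)[OF stochastic_row[OF R] sv]],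
          rule order_trans[OF a(2)]) (simp add: e_def algebra_simps)
    also have "\<dots> = 2 * S * a * mean (R x) v + e"
      by (rule mean_affine(2)[OF stochastic_row[OF R] sv])
    finally have 1: "\<bar>mean (R x) ?H - mean (R x) ?G\<bar> \<le> 2 * S * a * mean (R x) v + e"
      by (simp only: mean_diff(2)[OF sH sG])
    have 2: "\<bar>mean (lcb_truncation n R x) ?H - mean (R x) ?H\<bar> \<le> 2 * S * mean (R x) v"
      unfolding S_def by (rule abs_mean_lcb_truncation_diff_le[OF R v sv H])
    have "\<bar>mean (lcb_truncation n R x) ?H - mean (R x) ?G\<bar>
        \<le> 2 * S * (1 + a) * mean (R x) v + e"
      using 1 2 by (simp add: algebra_simps)
    also have "\<dots> \<le> 2 * S * (1 + a) * (\<gamma> * v x + b) + e"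
      using drift[of x] S a(1) by (intro add_right_mono mult_left_mono) auto
    also have "\<dots> = 2 * S * (\<gamma> * (1 + a) * (v x - B) + real (Suc m) * B)"
      unfolding e_def bB by (simp add: algebra_simps)
    finally show ?thesis .
  qed
  then show ?case
    using a(1) \<gamma> unfolding S_def B_def by (intro exI[of _ "\<gamma> * (1 + a)"]) simp
qed

subsection \<open>The phase chain\<close>

text \<open>The positive part \<open>h\<close> of \<open>p - q\<close> is subinvariant, and
  comparing totals makes it invariant. Its support is then closed, so empty or everything; equal
  masses exclude the latter. Hence \<open>p \<le> q\<close> entrywise, and equal masses force
  equality.\<close>

lemma finite_invariant_vector_unique:
  fixes \<psi> :: "'d::finite mat" and p q :: "'d vec"
  assumes \<psi>: "\<And>i j. 0 \<le> \<psi> i j" "\<And>i. (\<Sum>j\<in>UNIV. \<psi> i j) = 1"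
    and irr: "\<And>A. (\<And>i j. i \<in> A \<Longrightarrow> 0 < \<psi> i j \<Longrightarrow> j \<in> A) \<Longrightarrow> A = {} \<or> A = UNIV"
    and p: "\<And>j. p j = (\<Sum>i\<in>UNIV. p i * \<psi> i j)" and q: "\<And>j. q j = (\<Sum>i\<in>UNIV. q i * \<psi> i j)"
    and mass: "(\<Sum>j\<in>UNIV. p j) = (\<Sum>j\<in>UNIV. q j)"
  shows "p = q"
proof -
  define h where "h i = max (p i - q i) 0" for i
  have hpos: "0 < h i \<longleftrightarrow> q i < p i" for i by (auto simp: h_def)
  have le: "h j \<le> (\<Sum>i\<in>UNIV. h i * \<psi> i j)" for j
  proof -
    have "p j - q j = (\<Sum>i\<in>UNIV. (p i - q i) * \<psi> i j)"
      using p[of j] q[of j] by (simp add: left_diff_distrib sum_subtractf)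
    also have "\<dots> \<le> (\<Sum>i\<in>UNIV. h i * \<psi> i j)"
      by (intro sum_mono mult_right_mono \<psi>) (simp add: h_def)
    finally show ?thesis
      unfolding h_def[of j] by (auto intro!: sum_nonneg mult_nonneg_nonneg \<psi> simp: h_def)
  qed
  have "(\<Sum>j\<in>UNIV. \<Sum>i\<in>UNIV. h i * \<psi> i j) = (\<Sum>i\<in>UNIV. \<Sum>j\<in>UNIV. h i * \<psi> i j)"
    by (rule sum.swap)
  then have sum_eq: "(\<Sum>j\<in>UNIV. h j) = (\<Sum>j\<in>UNIV. \<Sum>i\<in>UNIV. h i * \<psi> i j)"
    by (simp add: \<psi> flip: sum_distrib_left)
  have inv: "h j = (\<Sum>i\<in>UNIV. h i * \<psi> i j)" for j
    by (rule sum_mono_inv[OF sum_eq le]) simp_all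
  have "{i. 0 < h i} = {} \<or> {i. 0 < h i} = UNIV"
  proof (rule irr)
    fix i j assume i: "i \<in> {i. 0 < h i}" and ij: "0 < \<psi> i j"
    have "0 < h i * \<psi> i j" using i ij by simp
    also have "\<dots> \<le> (\<Sum>i\<in>UNIV. h i * \<psi> i j)"
      by (rule member_le_sum) (auto simp: h_def \<psi>)
    finally show "j \<in> {i. 0 < h i}" using inv[of j] by simp
  qed
  moreover have "{i. 0 < h i} \<noteq> UNIV"
  proof
    assume "{i. 0 < h i} = UNIV"
    then have "q i < p i" for i using hpos by blast
    then have "(\<Sum>i\<in>UNIV. q i) < (\<Sum>i\<in>UNIV. p i)" by (intro sum_strict_mono) auto
    with mass show False by simp
  qed
  ultimately have "p i \<le> q i" for i using hpos not_less by blast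
  then show ?thesis
    using sum_mono_inv[OF mass] by (intro ext) simp
qed

text \<open>Invariance is tested against the indicator of a single phase, whose row means depend
  only on the starting phase.\<close>

lemma phase_marginal_stationary:
  fixes R :: "(nat \<times> 'd::finite) mat"
  assumes R: "stochastic R" and p: "stationary_prob R p"
    and \<psi>: "\<And>x j. phase_marginal (R x) j = \<psi> (snd x) j"
  shows "phase_marginal p j = (\<Sum>i\<in>UNIV. phase_marginal p i * \<psi> i j)"
proof -
  have pv: "prob_vec p" using p by (rule stationary_prob_vec)
  let ?d = "\<lambda>i. of_bool (i = j) :: real"
  have "phase_marginal p j = mean p (\<lambda>x. ?d (snd x))"
    by (simp add: mean_phase_function[OF pv, of ?d])
  also have "\<dots> = mean p (\<lambda>x. mean (R x) (\<lambda>y. ?d (snd y)))"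
    by (rule stationary_mean[OF R p, of _ 1, symmetric]) simp
  also have "\<dots> = mean p (\<lambda>x. \<psi> (snd x) j)"
    by (simp add: mean_phase_function[OF stochastic_row[OF R], of _ ?d] \<psi>)
  finally show ?thesis by (simp add: mean_phase_function[OF pv, of "\<lambda>i. \<psi> i j"])
qed

text \<open>Serves to pass irreducibility from the chain to its phases: a closed proper set of
  phases would trap the chain.\<close>

lemma mat_pow_positive_phase:
  fixes P :: "(nat \<times> 'd::finite) mat"
  assumes P: "stochastic P"
    and closed: "\<And>x j. snd x \<in> A \<Longrightarrow> 0 < phase_marginal (P x) j \<Longrightarrow> j \<in> A"
    and x: "snd x \<in> A"
  shows "0 < mat_pow P n x y \<Longrightarrow> snd y \<in> A"
proof (induction n arbitrary: y)
  case 0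
  then show ?case using x by (auto split: if_splits)
next
  case (Suc n)
  have "\<not> (\<forall>z. mat_pow P n x z * P z y \<le> 0)"
  proof
    assume "\<forall>z. mat_pow P n x z * P z y \<le> 0"
    then have "0 \<le> (\<Sum>\<^sub>\<infinity>z. - (mat_pow P n x z * P z y))"
      by (intro infsum_nonneg) (simp del: split_paired_All)
    then have "(\<Sum>\<^sub>\<infinity>z. mat_pow P n x z * P z y) \<le> 0" by (simp add: infsum_uminus)
    with Suc.prems show False by simp
  qed
  then obtain z where "0 < mat_pow P n x z * P z y" using not_less by blast
  \<comment> \<open>Nonnegativity of \<open>P z y\<close> excludes two negative factors.\<close>
  then have z: "0 < mat_pow P n x z" "0 < P z y"
    using stochastic_nonneg[OF P, of z y] by (simp_all add: zero_less_mult_iff)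
  have "0 < phase_marginal (P z) (snd y)"
    using z(2) le_phase_marginal[OF stochastic_row[OF P], of z "fst y" "snd y"] by simp
  then show ?case using closed Suc.IH z(1) by blast
qed

subsection \<open>The error bound\<close>

theorem theorem4p1:
  fixes P Q :: "(nat \<times> 'd::finite) mat"
    and \<pi> v :: "(nat \<times> 'd) vec"
    and \<gamma> b :: real
  assumes "stochastic P" and "irreducible_chain P" and "positive_recurrent P"
    and "stochastic Q" and "irreducible_chain Q" and "positive_recurrent Q"
    and "stationary_prob P \<pi>"
    and "block_monotone Q"
    and "block_dominated P Q"
    and "\<forall>k i. 1 \<le> v (k, i)" and "\<forall>k i. v (k, i) \<le> v (k + 1, i)"
    and "0 < \<gamma>" and "\<gamma> < 1" and "0 < b"
    and "drift_ineq Q v \<gamma> b"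
  shows "\<forall>n\<ge>1. \<forall>m\<ge>1. \<forall>\<pi>\<^sub>n. stationary_prob (lcb_truncation n P) \<pi>\<^sub>n \<longrightarrow>
           l1_norm (\<lambda>x. \<pi>\<^sub>n x - \<pi> x)
             \<le> b / (1 - \<gamma>) * (4 * \<gamma> ^ m + 2 * real m * (\<Sum>i\<in>UNIV. 1 / v (n, i)))"
proof (intro allI impI)
  fix n m :: nat and \<pi>\<^sub>n
  assume \<pi>n: "stationary_prob (lcb_truncation n P) \<pi>\<^sub>n"
  define Pn where "Pn = lcb_truncation n P"
  define B where "B = b / (1 - \<gamma>)"
  define S where "S = (\<Sum>i\<in>UNIV. 1 / v (n, i))"
  note P = assms(1) and Q = assms(4) and \<pi> = assms(7)
  have Pn: "stochastic Pn" unfolding Pn_def by (rule stochastic_lcb_truncation[OF P])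
  have \<pi>n: "stationary_prob Pn \<pi>\<^sub>n" using \<pi>n by (simp add: Pn_def)
  have pv: "prob_vec \<pi>" "prob_vec \<pi>\<^sub>n"
    using stationary_prob_vec[OF \<pi>] stationary_prob_vec[OF \<pi>n] .
  have v1: "1 \<le> v x" for x using assms(10) by (cases x) simp
  have v0: "0 \<le> v x" for x using v1[of x] by simp
  have vm: "level_mono v" using assms(11) by (simp add: level_mono_iff_Suc)
  have \<gamma>: "0 \<le> \<gamma>" "\<gamma> < 1" and b: "0 \<le> b" using assms(12-14) by simp_all
  have PQ: "tails_le (P x) (Q x)" for x
    using assms(9) by (cases x) (simp add: block_dominated_def tails_le_def)
  have PnQ: "tails_le (Pn x) (Q x)" for x
    unfolding Pn_def by (rule tails_le_trans[OF tails_le_lcb_truncation[OF P] PQ])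
  have Qm: "tails_le (Q (k, i)) (Q (Suc k, i))" for k i
    using assms(8) by (simp add: block_monotone_def tails_le_def)
  have sQv: "(\<lambda>y. Q x y * v y) summable_on UNIV"
    and Qv: "mean (Q x) v \<le> \<gamma> * v x + b * level0_indicator x" for x
    using assms(15) unfolding drift_ineq_def mean_def by blast+
  have Qv0: "mean (Q x) v \<le> \<gamma> * v x" if "fst x \<noteq> 0" for x
    using Qv[of x] that by (simp add: level0_indicator_def case_prod_unfold)
  have Qvb: "mean (Q x) v \<le> \<gamma> * v x + b" for x
    using Qv[of x] b by (auto simp: level0_indicator_def case_prod_unfold split: if_splits)
  \<comment> \<open>Monotonicity of \<open>v\<close> passes the drift inequality from
    \<open>Q\<close> to every dominated stochastic matrix, such as \<open>P\<close> and its
    truncation.\<close>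
  have v_drift: "(\<lambda>y. R x y * v y) summable_on UNIV" "mean (R x) v \<le> \<gamma> * v x + b"
    if R: "stochastic R" and RQ: "\<And>x. tails_le (R x) (Q x)" for R x
    using tails_le_mean[OF stochastic_row[OF R] stochastic_row[OF Q] RQ vm v0 sQv, of x] Qvb[of x]
    by simp_all
  note Pv = v_drift[OF P PQ] and Pnv = v_drift[OF Pn PnQ]
  have \<pi>v: "(\<lambda>x. \<pi> x * v x) summable_on UNIV" "mean \<pi> v \<le> B"
    unfolding B_def by (rule stationary_mean_drift[OF P \<pi> Pv v0 \<gamma> b])+
  have \<pi>nv: "(\<lambda>x. \<pi>\<^sub>n x * v x) summable_on UNIV" "mean \<pi>\<^sub>n v \<le> B"
    unfolding B_def by (rule stationary_mean_drift[OF Pn \<pi>n Pnv v0 \<gamma> b])+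
  \<comment> \<open>Level 0 represents all levels: monotonicity of \<open>Q\<close> equates its
    phase marginals at consecutive levels, and dominance equates those of \<open>P\<close> and
    \<open>Pn\<close> with them.\<close>
  define \<psi> where "\<psi> i j = phase_marginal (Q (0, i)) j" for i j
  have Q\<psi>: "phase_marginal (Q (k, i)) j = \<psi> i j" for k i j
    by (induction k)
      (simp_all add: \<psi>_def
        flip: tails_le_phase_marginal_eq[OF stochastic_row[OF Q] stochastic_row[OF Q] Qm])
  have \<psi>: "phase_marginal (R x) j = \<psi> (snd x) j"
    if R: "stochastic R" and RQ: "\<And>x. tails_le (R x) (Q x)" for R x j
    using tails_le_phase_marginal_eq[OF stochastic_row[OF R] stochastic_row[OF Q] RQ] Q\<psi>
    by (cases x) simp
  have phases: "phase_marginal \<pi>\<^sub>n = phase_marginal \<pi>"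
  proof (rule finite_invariant_vector_unique)
    show "0 \<le> \<psi> i j" "(\<Sum>j\<in>UNIV. \<psi> i j) = 1" for i j
      unfolding \<psi>_def
      by (simp_all add: phase_marginal_nonneg sum_phase_marginal stochastic_row Q)
    show "phase_marginal \<pi>\<^sub>n j = (\<Sum>i\<in>UNIV. phase_marginal \<pi>\<^sub>n i * \<psi> i j)" for j
      by (rule phase_marginal_stationary[OF Pn \<pi>n \<psi>[OF Pn PnQ]])
    show "phase_marginal \<pi> j = (\<Sum>i\<in>UNIV. phase_marginal \<pi> i * \<psi> i j)" for j
      by (rule phase_marginal_stationary[OF P \<pi> \<psi>[OF P PQ]])
    show "(\<Sum>j\<in>UNIV. phase_marginal \<pi>\<^sub>n j) = (\<Sum>j\<in>UNIV. phase_marginal \<pi> j)"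
      by (simp add: sum_phase_marginal pv)
    fix A assume A: "\<And>i j. i \<in> A \<Longrightarrow> 0 < \<psi> i j \<Longrightarrow> j \<in> A"
    have "j \<in> A" if "i \<in> A" for i j
    proof -
      obtain t where "0 < mat_pow P t (0, i) (0, j)"
        using assms(2) unfolding irreducible_chain_def by blast
      moreover have "l \<in> A" if "snd x \<in> A" "0 < phase_marginal (P x) l" for x l
        using A[OF that(1)] that(2) unfolding \<psi>[OF P PQ] by blast
      ultimately show ?thesis
        using mat_pow_positive_phase[OF P, of A "(0, i)" t "(0, j)"] that by fastforce
    qed
    then show "A = {} \<or> A = UNIV" by blast
  qed
  define g where "g x = sgn (\<pi>\<^sub>n x - \<pi> x)" for x
  have g: "\<bar>g x\<bar> \<le> 1" for x by (simp add: g_def abs_sgn_eq)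
  define G where "G = ((\<lambda>f x. mean (P x) f) ^^ m) g"
  define H where "H = ((\<lambda>f x. mean (Pn x) f) ^^ m) g"
  have G: "\<bar>G x\<bar> \<le> 1" and H: "\<bar>H x\<bar> \<le> 1" for x
    unfolding G_def H_def by (intro abs_iterate_le P Pn g)+
  have "l1_norm (\<lambda>x. \<pi>\<^sub>n x - \<pi> x) = mean \<pi>\<^sub>n g - mean \<pi> g"
  proof -
    have "((\<lambda>x. \<pi>\<^sub>n x * g x + (- 1) * (\<pi> x * g x)) has_sum (mean \<pi>\<^sub>n g + (- 1) * mean \<pi> g)) UNIV"
      unfolding mean_def
      by (intro has_sum_add has_sum_cmult_right has_sum_infsum summable_mean_bounded[OF _ g] pv)
    moreover have "\<pi>\<^sub>n x * g x + (- 1) * (\<pi> x * g x) = \<bar>\<pi>\<^sub>n x - \<pi> x\<bar>" for x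
      unfolding abs_sgn g_def by (simp add: left_diff_distrib)
    ultimately show ?thesis unfolding l1_norm_def by (simp add: infsumI)
  qed
  also have "\<dots> = mean \<pi>\<^sub>n H - mean \<pi> G"
    unfolding G_def H_def
    by (simp only: stationary_mean_iterate[OF P \<pi> g] stationary_mean_iterate[OF Pn \<pi>n g])
  \<comment> \<open>\<open>H (0, snd x)\<close> depends on the phase only, so equal phase marginals
    allow replacing \<open>\<pi>\<^sub>n\<close> by \<pi> under it. The outer terms are
    oscillations, the middle one is the truncation error at level 0.\<close>
  also have "\<dots> = (mean \<pi>\<^sub>n H - mean \<pi>\<^sub>n (\<lambda>x. H (0, snd x)))
      + (mean \<pi> (\<lambda>x. H (0, snd x)) - mean \<pi> (\<lambda>x. G (0, snd x)))
      + (mean \<pi> (\<lambda>x. G (0, snd x)) - mean \<pi> G)"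
  proof -
    have "mean \<pi>\<^sub>n (\<lambda>x. H (0, snd x)) = mean \<pi> (\<lambda>x. H (0, snd x))"
      using mean_phase_function[OF pv(1), of "\<lambda>i. H (0, i)"]
        mean_phase_function[OF pv(2), of "\<lambda>i. H (0, i)"] by (simp add: phases)
    then show ?thesis by simp
  qed
  also have "\<dots> \<le> 2 * \<gamma> ^ m * B + 2 * S * (real m * B) + 2 * \<gamma> ^ m * B"
  proof (intro add_mono)
    have sG: "(\<lambda>x. p x * G (f x)) summable_on UNIV" "(\<lambda>x. p x * H (f x)) summable_on UNIV"
      if "prob_vec p" for p and f :: "nat \<times> 'd \<Rightarrow> nat \<times> 'd"
      by (rule summable_mean_bounded[OF that], rule G, rule summable_mean_bounded[OF that], rule H)
    have oG: "\<bar>G (0, snd x) - G x\<bar> \<le> 2 * \<gamma> ^ m * v x" for x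
      unfolding G_def by (rule iterate_oscillation[OF P Q PQ Qm v1 sQv Qv0 \<gamma>(1) g])
    have oH: "\<bar>H x - H (0, snd x)\<bar> \<le> 2 * \<gamma> ^ m * v x" for x
      unfolding H_def abs_minus_commute[of _ "((\<lambda>f x. mean (Pn x) f) ^^ m) g (0, snd x)"]
      by (rule iterate_oscillation[OF Pn Q PnQ Qm v1 sQv Qv0 \<gamma>(1) g])
    have g0: "0 \<le> 2 * \<gamma> ^ m" using \<gamma> by simp
    have "mean \<pi>\<^sub>n H - mean \<pi>\<^sub>n (\<lambda>x. H (0, snd x)) = mean \<pi>\<^sub>n (\<lambda>x. H x - H (0, snd x))"
      by (rule mean_diff(2)[OF sG(2)[OF pv(2)] sG(2)[OF pv(2)], symmetric])
    also have "\<dots> \<le> mean \<pi>\<^sub>n (\<lambda>x. 2 * \<gamma> ^ m * v x)"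
      using abs_mean_le_mean(2)[OF pv(2) summable_mean_cmult[OF \<pi>nv(1)] oH] by simp
    also have "\<dots> \<le> 2 * \<gamma> ^ m * B"
      unfolding mean_cmult by (rule mult_left_mono[OF \<pi>nv(2) g0])
    finally show "mean \<pi>\<^sub>n H - mean \<pi>\<^sub>n (\<lambda>x. H (0, snd x)) \<le> 2 * \<gamma> ^ m * B" .
    have "mean \<pi> (\<lambda>x. G (0, snd x)) - mean \<pi> G = mean \<pi> (\<lambda>x. G (0, snd x) - G x)"
      by (rule mean_diff(2)[OF sG(1)[OF pv(1)] sG(1)[OF pv(1)], symmetric])
    also have "\<dots> \<le> mean \<pi> (\<lambda>x. 2 * \<gamma> ^ m * v x)"
      using abs_mean_le_mean(2)[OF pv(1) summable_mean_cmult[OF \<pi>v(1)] oG] by simp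
    also have "\<dots> \<le> 2 * \<gamma> ^ m * B"
      unfolding mean_cmult by (rule mult_left_mono[OF \<pi>v(2) g0])
    finally show "mean \<pi> (\<lambda>x. G (0, snd x)) - mean \<pi> G \<le> 2 * \<gamma> ^ m * B" .
    obtain a where a: "0 \<le> a" "\<And>x. \<bar>H x - G x\<bar> \<le> 2 * S * (a * (v x - B) + real m * B)"
      using iterate_lcb_truncation_diff_le[where R = P and n = n and m = m and g = g,
          OF P v1 vm Pv \<gamma> g]
      unfolding S_def B_def G_def H_def Pn_def by auto
    define e where "e = 2 * S * (real m * B - a * B)"
    have S: "0 \<le> S" unfolding S_def using v0 by (intro sum_nonneg) simp
    \<comment> \<open>Within a phase \<open>v\<close> is least at level 0, so the error there is
      bounded through \<open>v x\<close>, whose integral is controlled.\<close>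
    have "\<bar>H (0, snd x) - G (0, snd x)\<bar> \<le> 2 * S * a * v x + e" for x
    proof -
      have "v (0, snd x) \<le> v x"
        using vm monoD[of "\<lambda>l. v (l, snd x)" 0 "fst x"] by (simp add: level_mono_def)
      then have "2 * S * a * v (0, snd x) \<le> 2 * S * a * v x"
        using S a(1) by (intro mult_left_mono) simp_all
      then show ?thesis
        using a(2)[of "(0, snd x)"] by (simp add: e_def algebra_simps)
    qed
    note pt = this
    have "mean \<pi> (\<lambda>x. H (0, snd x)) - mean \<pi> (\<lambda>x. G (0, snd x))
        = mean \<pi> (\<lambda>x. H (0, snd x) - G (0, snd x))"
      by (rule mean_diff(2)[OF sG(2)[OF pv(1)] sG(1)[OF pv(1)], symmetric])
    also have "\<dots> \<le> mean \<pi> (\<lambda>x. 2 * S * a * v x + e)"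
      using abs_mean_le_mean(2)[OF pv(1) mean_affine(1)[OF pv(1) \<pi>v(1)] pt] by simp
    also have "\<dots> = 2 * S * a * mean \<pi> v + e" by (rule mean_affine(2)[OF pv(1) \<pi>v(1)])
    \<comment> \<open>As \<open>mean \<pi> v \<le> B\<close> and \<open>a\<close> is nonnegative,
      the excess term integrates to at most 0, and the unknown \<open>a\<close> drops out.\<close>
    also have "\<dots> \<le> 2 * S * a * B + e"
      using S a(1) \<pi>v(2) by (intro add_right_mono mult_left_mono) simp_all
    also have "\<dots> = 2 * S * (real m * B)" by (simp add: e_def algebra_simps)
    finally show "mean \<pi> (\<lambda>x. H (0, snd x)) - mean \<pi> (\<lambda>x. G (0, snd x)) \<le> 2 * S * (real m * B)" .
  qed
  also have "\<dots> = B * (4 * \<gamma> ^ m + 2 * real m * S)" by (simp add: algebra_simps)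
  finally show "l1_norm (\<lambda>x. \<pi>\<^sub>n x - \<pi> x)
      \<le> b / (1 - \<gamma>) * (4 * \<gamma> ^ m + 2 * real m * (\<Sum>i\<in>UNIV. 1 / v (n, i)))"
    by (simp only: B_def S_def)
qed

end
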